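(* Let $(\alpha_n)_{n\ge0}$ be the sequence of pseudo-factorials. (i) The sequence $(\alpha_n)$ is eventually periodic modulo any integer $M\ge2$. (ii) For each integer $m\ge2$, the sequence $(\alpha_n)$ satisfies, modulo $M=3^{\lceil m/2\rceil}\,m!^2$, a linear recurrence with constant coefficients that is of order at most $m$.
   Context: The pseudo-factorials $(\alpha_n)_{n\ge 0}$ are the integers defined by $\alpha_0=1$ and $\alpha_{n+1}=(-1)^{n+1}\sum_{k=0}^n\binom{n}{k}\alpha_k\alpha_{n-k}$ for $n\ge 0$. A sequence satisfies modulo $M$ a linear recurrence with constant coefficients of order $d$ if there are integers $b_1,\dots,b_d$ such that $\alpha_{n+d}\equiv b_1\alpha_{n+d-1}+\cdots+b_d\alpha_n \pmod M$ for all $n\ge0$. Here $m!^2=(m!)^2$. *)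

theory Defs
  imports Complex_Main "HOL-Number_Theory.Cong"
begin

fun pseudo_factorial :: "nat \<Rightarrow> int" where
  "pseudo_factorial 0 = 1"
| "pseudo_factorial (Suc n) =
     (-1) ^ (n + 1) * (\<Sum>k\<le>n. int (n choose k) * pseudo_factorial k * pseudo_factorial (n - k))"

definition eventually_periodic_mod :: "(nat \<Rightarrow> int) \<Rightarrow> int \<Rightarrow> bool" where
  "eventually_periodic_mod u M \<longleftrightarrow>
     (\<exists>N p. p > 0 \<and> (\<forall>n\<ge>N. [u (n + p) = u n] (mod M)))"

definition linear_recurrence_mod :: "(nat \<Rightarrow> int) \<Rightarrow> int \<Rightarrow> nat \<Rightarrow> bool" where
  "linear_recurrence_mod u M d \<longleftrightarrow>
     (\<exists>b :: nat \<Rightarrow> int. \<forall>n. [u (n + d) = (\<Sum>i=1..d. b i * u (n + d - i))] (mod M))"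

end

theory Submission
  imports Defs "HOL-Computational_Algebra.Computational_Algebra"
begin

text \<open>
  Everything rests on a continued fraction with integer coefficients. Let \<open>f\<close> be the exponential
  generating function of the pseudo-factorials and \<open>g(z) = f(-z)\<close>. The defining recurrence says
  \<open>f' = -g\<^sup>2\<close>, so \<open>g' = f\<^sup>2\<close>, and therefore \<open>f\<^sup>3 + g\<^sup>3\<close> is the constant \<open>2\<close>. Put \<open>u = 1 - f g\<close>; this
  series is \<open>3 z\<^sup>2 + \<dots>\<close>. The two families \<open>f u\<^sup>j\<close> and \<open>(g\<^sup>2 - f) u\<^sup>j\<close> have orders \<open>2 j\<close> and
  \<open>2 j + 1\<close>, and by means of the cubic relation the derivative of each member becomes a combination
  of the member itself and its two neighbours in order (\<open>deriv_even_basis\<close>, \<open>deriv_odd_basis\<close>).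

  On the level of coefficients such a three-term rule is the transfer rule of weighted Motzkin
  paths, so the pseudo-factorial of index \<open>k\<close> is the total weight of the paths of length \<open>k\<close> that
  return to height \<open>0\<close> (\<open>pseudo_factorial_eq_motzkin\<close>); level steps at the heights \<open>0, 1, 2, 3, \<dots>\<close>
  weigh \<open>-1, 1, -3, 3, \<dots>\<close>, and descents from height \<open>n\<close> weigh \<open>-n\<^sup>2\<close> or \<open>-3 n\<^sup>2\<close> as \<open>n\<close> is even or
  odd. Equivalently, the ordinary generating function is a Jacobi continued fraction with these
  integer coefficients.

  For any such path count the monic orthogonal polynomial of degree \<open>m\<close>, used as a linear recurrence
  operator, sends the sequence of weights of closed paths to a multiple of the product of the first
  \<open>m\<close> descent weights (\<open>apply_orthogonal_poly\<close>). Here this product is \<open>\<plusminus>3\<^bsup>\<lceil>m/2\<rceil>\<^esup> m!\<^sup>2\<close>, which yields the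
  recurrence of order \<open>m\<close>. Every modulus \<open>M\<close> divides such a product for large \<open>m\<close>, and a sequence
  that satisfies a linear recurrence over a finite ring is eventually periodic by the pigeonhole
  principle (\<open>linear_recurrence_mod_imp_eventually_periodic_mod\<close>).
\<close>

section \<open>Linear recurrences and periodicity\<close>

text \<open>
  A recurrence of order \<open>d\<close> determines the sequence modulo \<open>M\<close> from any window of \<open>d\<close> consecutive
  residues onwards, and there are only finitely many such windows.
\<close>

lemma linear_recurrence_mod_imp_eventually_periodic_mod:
  assumes "linear_recurrence_mod u M d" and "M > 0"
  shows "eventually_periodic_mod u M"
proof -
  obtain b where b: "[u (n + d) = (\<Sum>i=1..d. b i * u (n + d - i))] (mod M)" for n
    using assms(1) by (auto simp: linear_recurrence_mod_def)
  define window where "window = (\<lambda>n. map (\<lambda>i. u (n + i) mod M) [0..<d])"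
  have "range window \<subseteq> {xs. set xs \<subseteq> {0..<M} \<and> length xs = d}"
    using assms(2) by (auto simp: window_def)
  then have "finite (range window)"
    using finite_lists_length_eq[of "{0..<M}" d] finite_subset by blast
  then have "\<not> inj window"
    using finite_imageD by blast
  then obtain x y where "x < y" and xy: "window x = window y"
    unfolding inj_def by (metis linorder_neqE_nat)
  have same: "[u (y + j) = u (x + j)] (mod M)" for j
  proof (induction j rule: less_induct)
    case (less j)
    show ?case
    proof (cases "j < d")
      case True
      then have "window x ! j = window y ! j"
        using xy by simp
      with True show ?thesis
        by (simp add: window_def cong_def)
    next
      case False
      define t where "t = j - d"
      have j: "j = t + d"
        using False by (simp add: t_def)
      have "[u (y + j) = (\<Sum>i=1..d. b i * u (y + t + d - i))] (mod M)"
        using b[of "y + t"] by (simp add: j add.assoc)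
      also have "[(\<Sum>i=1..d. b i * u (y + t + d - i)) =
                  (\<Sum>i=1..d. b i * u (x + t + d - i))] (mod M)"
      proof (intro cong_sum cong_mult cong_refl)
        fix i assume i: "i \<in> {1..d}"
        have "[u (y + (j - i)) = u (x + (j - i))] (mod M)"
          using less[of "j - i"] i j by auto
        then show "[u (y + t + d - i) = u (x + t + d - i)] (mod M)"
          using i j by (simp add: add.assoc)
      qed
      also have "[(\<Sum>i=1..d. b i * u (x + t + d - i)) = u (x + j)] (mod M)"
        using cong_sym[OF b[of "x + t"]] by (simp add: j add.assoc)
      finally show ?thesis .
    qed
  qed
  have "[u (n + (y - x)) = u n] (mod M)" if "n \<ge> x" for n
  proof -
    have "y + (n - x) = n + (y - x)" "x + (n - x) = n"
      using that \<open>x < y\<close> by auto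
    with same[of "n - x"] show ?thesis
      by simp
  qed
  then show ?thesis
    unfolding eventually_periodic_mod_def using \<open>x < y\<close> by (intro exI[of _ x] exI[of _ "y - x"]) auto
qed

section \<open>Motzkin paths and orthogonal polynomials\<close>

text \<open>
  The total weight of the lattice paths from height \<open>0\<close> to height \<open>n\<close> with \<open>k\<close> steps that stay
  nonnegative, where an ascent weighs \<open>1\<close>, a level step at height \<open>i\<close> weighs \<open>c i\<close> and a descent
  from height \<open>i\<close> weighs \<open>l i\<close>. The recursion removes the last step.
\<close>

fun motzkin :: "(nat \<Rightarrow> int) \<Rightarrow> (nat \<Rightarrow> int) \<Rightarrow> nat \<Rightarrow> nat \<Rightarrow> int" where
  "motzkin c l 0 n = (if n = 0 then 1 else 0)"
| "motzkin c l (Suc k) n =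
     (case n of 0 \<Rightarrow> 0 | Suc i \<Rightarrow> motzkin c l k i) + c n * motzkin c l k n
       + l (Suc n) * motzkin c l k (Suc n)"

fun orthogonal_poly :: "(nat \<Rightarrow> int) \<Rightarrow> (nat \<Rightarrow> int) \<Rightarrow> nat \<Rightarrow> int poly" where
  "orthogonal_poly c l 0 = 1"
| "orthogonal_poly c l (Suc 0) = [:- c 0, 1:]"
| "orthogonal_poly c l (Suc (Suc n)) =
     [:- c (Suc n), 1:] * orthogonal_poly c l (Suc n) - smult (l (Suc n)) (orthogonal_poly c l n)"

lemma monic_orthogonal_poly:
  "degree (orthogonal_poly c l n) = n \<and> lead_coeff (orthogonal_poly c l n) = 1"
proof (induction c l n rule: orthogonal_poly.induct)
  case (3 c l n)
  let ?p = "[:- c (Suc n), 1:] * orthogonal_poly c l (Suc n)"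
  let ?q = "smult (l (Suc n)) (orthogonal_poly c l n)"
  have nz: "orthogonal_poly c l (Suc n) \<noteq> 0"
    using 3 by auto
  have p: "degree ?p = Suc (Suc n)"
    using 3 nz by (subst degree_mult_eq) auto
  have p1: "lead_coeff ?p = 1"
    using 3 by (subst lead_coeff_mult) auto
  have q: "degree ?q < Suc (Suc n)"
    using 3 degree_smult_le[of "l (Suc n)" "orthogonal_poly c l n"] by auto
  have "degree (?p - ?q) = Suc (Suc n)"
    using p q degree_add_eq_left[of "- ?q" ?p] by simp
  moreover have "coeff (?p - ?q) (Suc (Suc n)) = 1"
    using p p1 coeff_eq_0[OF q] by (metis coeff_diff diff_zero)
  ultimately show ?case
    by simp
qed auto

text \<open>
  The polynomial \<open>p\<close> acts on sequences as a recurrence operator, with the indeterminate as shift.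
\<close>

definition apply_shift_poly :: "int poly \<Rightarrow> (nat \<Rightarrow> int) \<Rightarrow> nat \<Rightarrow> int" where
  "apply_shift_poly p u k = (\<Sum>i\<le>degree p. coeff p i * u (k + i))"

lemma apply_shift_poly_alt:
  assumes "degree p \<le> n"
  shows "apply_shift_poly p u k = (\<Sum>i\<le>n. coeff p i * u (k + i))"
  unfolding apply_shift_poly_def
  by (rule sum.mono_neutral_left) (use assms in \<open>auto simp: coeff_eq_0\<close>)

lemma apply_shift_poly_diff:
  "apply_shift_poly (p - q) u k = apply_shift_poly p u k - apply_shift_poly q u k"
proof -
  let ?n = "max (degree p) (degree q)"
  have "degree (p - q) \<le> ?n" "degree p \<le> ?n" "degree q \<le> ?n"
    by (auto intro: degree_diff_le)
  then show ?thesis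
    by (simp add: apply_shift_poly_alt[of _ ?n] sum_subtractf left_diff_distrib)
qed

lemma apply_shift_poly_smult: "apply_shift_poly (smult a p) u k = a * apply_shift_poly p u k"
  using degree_smult_le[of a p]
  by (simp add: apply_shift_poly_alt[of _ "degree p"] sum_distrib_left mult.assoc)

lemma apply_shift_poly_pCons_0: "apply_shift_poly (pCons 0 p) u k = apply_shift_poly p u (Suc k)"
proof -
  have "apply_shift_poly (pCons 0 p) u k =
      (\<Sum>i\<le>Suc (degree p). coeff (pCons 0 p) i * u (k + i))"
    by (rule apply_shift_poly_alt) (auto simp: degree_pCons_le)
  also have "\<dots> = apply_shift_poly p u (Suc k)"
    by (subst sum.atMost_Suc_shift) (simp add: apply_shift_poly_def)
  finally show ?thesis .
qed

lemma apply_shift_poly_linear_mult: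
  "apply_shift_poly ([:- a, 1:] * p) u k = apply_shift_poly p u (Suc k) - a * apply_shift_poly p u k"
proof -
  have "[:- a, 1:] * p = pCons 0 p - smult a p"
    by (simp add: mult_pCons_left)
  then show ?thesis
    by (simp add: apply_shift_poly_diff apply_shift_poly_smult apply_shift_poly_pCons_0)
qed

text \<open>
  The last-step recursion of the paths can be solved for the term \<open>l (Suc n) * motzkin c l k (Suc n)\<close>.
  This expresses the weights at height \<open>n + 1\<close>, times one new descent weight, by those at the two
  heights below, and it is the three-term recurrence of the polynomials with the indeterminate read
  as the shift in \<open>k\<close>. The product collects one descent weight per height. Since all path weights are
  integers, it divides every value of the recurrence operator.
\<close>

lemma apply_orthogonal_poly:
  "apply_shift_poly (orthogonal_poly c l n) (\<lambda>k. motzkin c l k 0) k =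
     (\<Prod>i=1..n. l i) * motzkin c l k n"
proof (induction n arbitrary: k rule: less_induct)
  case (less n)
  consider "n = 0" | "n = 1" | m where "n = Suc (Suc m)"
    by (metis One_nat_def not0_implies_Suc)
  then show ?case
  proof cases
    case 1
    then show ?thesis by (simp add: apply_shift_poly_def)
  next
    case 2
    then show ?thesis by (simp add: apply_shift_poly_def)
  next
    case 3
    show ?thesis
      unfolding 3 orthogonal_poly.simps apply_shift_poly_diff apply_shift_poly_linear_mult
        apply_shift_poly_smult
      by (simp add: less 3 algebra_simps)
  qed
qed

lemma linear_recurrence_mod_motzkin:
  "linear_recurrence_mod (\<lambda>k. motzkin c l k 0) (\<Prod>i=1..m. l i) m"
proof -
  let ?p = "orthogonal_poly c l m"
  let ?u = "\<lambda>k. motzkin c l k 0"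
  have deg: "degree ?p = m" and lead: "coeff ?p m = 1"
    using monic_orthogonal_poly[of c l m] by auto
  have "[?u (n + m) = (\<Sum>i=1..m. - coeff ?p (m - i) * ?u (n + m - i))] (mod (\<Prod>i=1..m. l i))"
    for n
  proof -
    have "(\<Sum>i=1..m. - coeff ?p (m - i) * ?u (n + m - i)) = - (\<Sum>i<m. coeff ?p i * ?u (n + i))"
      unfolding sum_negf[symmetric]
      by (rule sum.reindex_bij_witness[of _ "\<lambda>i. m - i" "\<lambda>i. m - i"]) auto
    moreover have "apply_shift_poly ?p ?u n = (\<Sum>i<m. coeff ?p i * ?u (n + i)) + ?u (n + m)"
      unfolding apply_shift_poly_def deg lessThan_Suc_atMost[symmetric] by (simp add: lead)
    ultimately have "?u (n + m) - (\<Sum>i=1..m. - coeff ?p (m - i) * ?u (n + m - i)) =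
        (\<Prod>i=1..m. l i) * motzkin c l n m"
      by (simp add: apply_orthogonal_poly)
    then show ?thesis
      by (simp add: cong_iff_dvd_diff)
  qed
  then show ?thesis
    unfolding linear_recurrence_mod_def by (intro exI[of _ "\<lambda>i. - coeff ?p (m - i)"] allI)
qed

section \<open>The exponential generating function\<close>

definition pf_egf :: "rat fps" where
  "pf_egf = Abs_fps (\<lambda>n. of_int (pseudo_factorial n) / fact n)"

definition pf_egf_neg :: "rat fps" where
  "pf_egf_neg = Abs_fps (\<lambda>n. (-1) ^ n * of_int (pseudo_factorial n) / fact n)"

text \<open>
  The convolution in the defining recurrence is the \<open>n\<close>-th coefficient of \<open>f\<^sup>2\<close>. The sign
  \<open>(-1)\<^bsup>n+1\<^esup>\<close> turns it into that of \<open>-g\<^sup>2\<close> when it stands with the convolution, and \<open>f'\<close> into \<open>g'\<close>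
  when it stands with the pseudo-factorial.
\<close>

lemma pf_square_nth:
  "(\<Sum>k\<le>n. of_int (pseudo_factorial k) / fact k * (of_int (pseudo_factorial (n - k)) / fact (n - k)))
     = (-1) ^ (n + 1) * of_int (pseudo_factorial (Suc n)) / (fact n :: rat)"
proof -
  have "(\<Sum>k\<le>n. of_int (pseudo_factorial k) / fact k * (of_int (pseudo_factorial (n - k)) / fact (n - k)))
      = (\<Sum>k\<le>n. of_nat (n choose k) * of_int (pseudo_factorial k) * of_int (pseudo_factorial (n - k))) / (fact n :: rat)"
    unfolding sum_divide_distrib by (rule sum.cong) (auto simp: binomial_fact field_simps)
  then show ?thesis
    by (simp flip: power_add add: mult.assoc[symmetric] power_mult_distrib[symmetric])
qed

lemma deriv_pf_egf: "fps_deriv pf_egf = - pf_egf_neg\<^sup>2"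
proof (rule fps_ext)
  fix n
  have "(pf_egf_neg\<^sup>2) $ n = (-1) ^ n * (\<Sum>k\<le>n. of_int (pseudo_factorial k) / fact k *
      (of_int (pseudo_factorial (n - k)) / fact (n - k)))"
    unfolding power2_eq_square fps_mult_nth sum_distrib_left atLeast0AtMost
    by (rule sum.cong) (auto simp: pf_egf_neg_def simp flip: power_add)
  also have "\<dots> = - (of_int (pseudo_factorial (Suc n)) / fact n)"
    unfolding pf_square_nth by (simp del: pseudo_factorial.simps flip: power_add)
  finally show "fps_deriv pf_egf $ n = (- pf_egf_neg\<^sup>2) $ n"
    by (simp add: pf_egf_def del: pseudo_factorial.simps of_nat_Suc)
qed

lemma deriv_pf_egf_neg: "fps_deriv pf_egf_neg = pf_egf\<^sup>2"
proof (rule fps_ext)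
  fix n
  have "(pf_egf\<^sup>2) $ n = (-1) ^ (n + 1) * of_int (pseudo_factorial (Suc n)) / fact n"
    unfolding power2_eq_square fps_mult_nth pf_square_nth[symmetric] atLeast0AtMost
    by (simp add: pf_egf_def)
  then show "fps_deriv pf_egf_neg $ n = (pf_egf\<^sup>2) $ n"
    by (simp add: pf_egf_neg_def del: pseudo_factorial.simps of_nat_Suc)
qed

lemma pf_egf_cubic: "pf_egf ^ 3 + pf_egf_neg ^ 3 = 2"
proof -
  have "fps_deriv (pf_egf ^ 3 + pf_egf_neg ^ 3) = 0"
    by (simp add: deriv_pf_egf deriv_pf_egf_neg fps_deriv_power algebra_simps)
  then have "pf_egf ^ 3 + pf_egf_neg ^ 3 = fps_const ((pf_egf ^ 3 + pf_egf_neg ^ 3) $ 0)"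
    by (simp only: fps_deriv_eq_0_iff)
  also have "(pf_egf ^ 3 + pf_egf_neg ^ 3) $ 0 = 2"
    by (simp add: fps_power_zeroth pf_egf_def pf_egf_neg_def)
  finally show ?thesis
    by (simp add: numeral_fps_const)
qed

section \<open>A basis with a three-term derivative rule\<close>

definition pf_u :: "rat fps" where
  "pf_u = 1 - pf_egf * pf_egf_neg"

definition even_basis :: "nat \<Rightarrow> rat fps" where
  "even_basis j = pf_egf * pf_u ^ j"

definition odd_basis :: "nat \<Rightarrow> rat fps" where
  "odd_basis j = (pf_egf_neg\<^sup>2 - pf_egf) * pf_u ^ j"

lemma deriv_pf_u: "fps_deriv pf_u = pf_egf_neg ^ 3 - pf_egf ^ 3"
  by (simp add: pf_u_def deriv_pf_egf deriv_pf_egf_neg power2_eq_square power3_eq_cube algebra_simps)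

lemma deriv_pf_u_power:
  "fps_deriv (pf_u ^ Suc j) = of_nat (Suc j) * (pf_egf_neg ^ 3 - pf_egf ^ 3) * pf_u ^ j"
  by (simp add: fps_deriv_power deriv_pf_u fps_of_nat del: power_Suc of_nat_Suc)

text \<open>
  Multiplying either generator by \<open>u'\<close> lands, modulo the cubic relation, in the span of the basis:
  this is what keeps the derivative rules short.
\<close>

lemma pf_egf_times_deriv_u:
  "pf_egf * (pf_egf_neg ^ 3 - pf_egf ^ 3) = 2 * (pf_egf_neg\<^sup>2 - pf_egf) - 2 * pf_egf_neg\<^sup>2 * pf_u"
proof -
  have "pf_egf ^ 3 = 2 - pf_egf_neg ^ 3"
    using pf_egf_cubic by (simp add: eq_diff_eq)
  then have "pf_egf * (pf_egf_neg ^ 3 - pf_egf ^ 3) = pf_egf * (2 * pf_egf_neg ^ 3 - 2)"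
    by simp
  also have "\<dots> = 2 * (pf_egf_neg\<^sup>2 - pf_egf) - 2 * pf_egf_neg\<^sup>2 * pf_u"
    by (simp add: pf_u_def algebra_simps power2_eq_square power3_eq_cube)
  finally show ?thesis .
qed

lemma odd_generator_times_deriv_u:
  "(pf_egf_neg\<^sup>2 - pf_egf) * (pf_egf_neg ^ 3 - pf_egf ^ 3) =
     2 * pf_egf_neg\<^sup>2 * pf_u + 2 * pf_egf * pf_u * (2 - pf_u)"
proof -
  have f3: "pf_egf ^ 3 = 2 - pf_egf_neg ^ 3" and g3: "pf_egf_neg ^ 3 = 2 - pf_egf ^ 3"
    using pf_egf_cubic by (simp_all add: eq_diff_eq add.commute)
  have "pf_egf_neg\<^sup>2 * (pf_egf_neg ^ 3 - pf_egf ^ 3) = pf_egf_neg\<^sup>2 * (2 - 2 * pf_egf ^ 3)"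
    unfolding g3 by simp
  moreover have "pf_egf * (pf_egf_neg ^ 3 - pf_egf ^ 3) = pf_egf * (2 * pf_egf_neg ^ 3 - 2)"
    unfolding f3 by simp
  ultimately have "(pf_egf_neg\<^sup>2 - pf_egf) * (pf_egf_neg ^ 3 - pf_egf ^ 3) =
      pf_egf_neg\<^sup>2 * (2 - 2 * pf_egf ^ 3) - pf_egf * (2 * pf_egf_neg ^ 3 - 2)"
    by (simp only: left_diff_distrib)
  also have "\<dots> = 2 * pf_egf_neg\<^sup>2 * pf_u + 2 * pf_egf * pf_u * (2 - pf_u)"
    by (simp add: pf_u_def algebra_simps power2_eq_square power3_eq_cube)
  finally show ?thesis .
qed

lemma deriv_even_basis_0: "fps_deriv (even_basis 0) = - even_basis 0 - odd_basis 0"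
  by (simp add: even_basis_def odd_basis_def deriv_pf_egf)

lemma deriv_even_basis:
  "fps_deriv (even_basis (Suc j)) = of_nat (2 * j + 2) * odd_basis j
     - of_nat (2 * j + 3) * even_basis (Suc j) - of_nat (2 * j + 3) * odd_basis (Suc j)"
proof -
  have "fps_deriv (even_basis (Suc j)) = - pf_egf_neg\<^sup>2 * pf_u ^ Suc j
      + of_nat (Suc j) * (pf_egf * (pf_egf_neg ^ 3 - pf_egf ^ 3)) * pf_u ^ j"
    unfolding even_basis_def by (simp only: fps_deriv_mult deriv_pf_egf deriv_pf_u_power) algebra
  then show ?thesis
    unfolding pf_egf_times_deriv_u even_basis_def odd_basis_def by (simp add: algebra_simps)
qed

lemma deriv_odd_generator:
  "fps_deriv (pf_egf_neg\<^sup>2 - pf_egf) = pf_egf_neg\<^sup>2 + 2 * pf_egf * (1 - pf_u)"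
  by (simp add: deriv_pf_egf deriv_pf_egf_neg power2_eq_square pf_u_def algebra_simps)

lemma deriv_odd_basis:
  "fps_deriv (odd_basis j) = of_nat (3 * (2 * j + 1)) * even_basis j
     + of_nat (2 * j + 1) * odd_basis j - of_nat (2 * j + 2) * even_basis (Suc j)"
proof (cases j)
  case 0
  then show ?thesis
    by (simp add: odd_basis_def even_basis_def deriv_odd_generator algebra_simps
        del: fps_deriv_sub)
next
  case (Suc i)
  have "fps_deriv (odd_basis j) = (pf_egf_neg\<^sup>2 + 2 * pf_egf * (1 - pf_u)) * pf_u ^ Suc i
      + of_nat (Suc i) * ((pf_egf_neg\<^sup>2 - pf_egf) * (pf_egf_neg ^ 3 - pf_egf ^ 3)) * pf_u ^ i"
    unfolding odd_basis_def Suc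
    by (simp only: fps_deriv_mult deriv_odd_generator deriv_pf_u_power) algebra
  then show ?thesis
    unfolding odd_generator_times_deriv_u even_basis_def odd_basis_def Suc
    by (simp add: algebra_simps)
qed

section \<open>The continued fraction of the pseudo-factorials\<close>

definition pf_level :: "nat \<Rightarrow> int" where
  "pf_level n = (if even n then - int (n + 1) else int n)"

definition pf_descent :: "nat \<Rightarrow> int" where
  "pf_descent n = (if even n then - (int n)\<^sup>2 else - 3 * (int n)\<^sup>2)"

abbreviation pf_motzkin :: "nat \<Rightarrow> nat \<Rightarrow> rat" where
  "pf_motzkin k n \<equiv> of_int (motzkin pf_level pf_descent k n)"

lemma fps_nth_Suc_deriv:
  "(F :: 'a :: field_char_0 fps) $ Suc k = fps_deriv F $ k / of_nat (Suc k)"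
  by (simp del: of_nat_Suc)

lemma fps_of_nat_mult_nth: "(of_nat c * F) $ k = of_nat c * (F :: 'a :: field fps) $ k"
  by (simp flip: fps_of_nat)

text \<open>
  The factors \<open>3\<^sup>j (2 j)!\<close> and \<open>3\<^bsup>j+1\<^esup> (2 j + 1)!\<close> are the leading coefficients of the basis series
  times \<open>(2 j)!\<close> and \<open>(2 j + 1)!\<close>. Rescaled by them, the series are the exponential generating
  functions, in the number of steps, of the paths that end at height \<open>2 j\<close> and \<open>2 j + 1\<close>.
\<close>

lemma basis_nth_eq_motzkin:
  "even_basis j $ k = 3 ^ j * fact (2 * j) * pf_motzkin k (2 * j) / fact k \<and>
   odd_basis j $ k = 3 ^ (j + 1) * fact (2 * j + 1) * pf_motzkin k (2 * j + 1) / fact k"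
proof (induction k arbitrary: j)
  case 0
  show ?case
    by (simp add: even_basis_def odd_basis_def pf_u_def pf_egf_def pf_egf_neg_def fps_power_zeroth
        power_0_left)
next
  case (Suc k)
  have e: "even_basis j $ k = 3 ^ j * fact (2 * j) * pf_motzkin k (2 * j) / fact k" for j
    using Suc by blast
  have o: "odd_basis j $ k = 3 ^ (j + 1) * fact (2 * j + 1) * pf_motzkin k (2 * j + 1) / fact k" for j
    using Suc by blast
  let ?P = "\<lambda>j. 3 ^ j * fact (2 * j) * pf_motzkin k (2 * j)"
  let ?Q = "\<lambda>j. 3 ^ (j + 1) * fact (2 * j + 1) * pf_motzkin k (2 * j + 1)"
  \<comment> \<open>\<open>?P j\<close> and \<open>?Q j\<close> are the numerators over \<open>fact k\<close>. Clearing this denominator first leaves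
    polynomial identities in \<open>j\<close> that compare the derivative rules with the last-step recursion.\<close>
  have "even_basis j $ Suc k =
      3 ^ j * fact (2 * j) * pf_motzkin (Suc k) (2 * j) / fact (Suc k)"
  proof (cases j)
    case 0
    then show ?thesis
      unfolding fps_nth_Suc_deriv
      by (simp add: deriv_even_basis_0 e o pf_level_def pf_descent_def field_simps)
  next
    case (Suc i)
    have "of_nat (2 * i + 2) * ?Q i - of_nat (2 * i + 3) * ?P j - of_nat (2 * i + 3) * ?Q j =
        3 ^ j * fact (2 * j) * pf_motzkin (Suc k) (2 * j)"
      by (simp add: Suc pf_level_def pf_descent_def algebra_simps power2_eq_square)
    moreover have "even_basis j $ Suc k =
        (of_nat (2 * i + 2) * ?Q i - of_nat (2 * i + 3) * ?P j - of_nat (2 * i + 3) * ?Q j)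
          / fact (Suc k)"
      unfolding fps_nth_Suc_deriv Suc deriv_even_basis fps_sub_nth fps_of_nat_mult_nth e o
      by (simp only: times_divide_eq_right diff_divide_distrib[symmetric] divide_divide_eq_left
          fact_Suc of_nat_mult mult.commute[of "fact k"])
    ultimately show ?thesis
      by simp
  qed
  moreover have "odd_basis j $ Suc k =
      3 ^ (j + 1) * fact (2 * j + 1) * pf_motzkin (Suc k) (2 * j + 1) / fact (Suc k)"
  proof -
    have "of_nat (3 * (2 * j + 1)) * ?P j + of_nat (2 * j + 1) * ?Q j
          - of_nat (2 * j + 2) * ?P (Suc j) =
        3 ^ (j + 1) * fact (2 * j + 1) * pf_motzkin (Suc k) (2 * j + 1)"
      by (simp add: pf_level_def pf_descent_def algebra_simps power2_eq_square)
    moreover have "odd_basis j $ Suc k =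
        (of_nat (3 * (2 * j + 1)) * ?P j + of_nat (2 * j + 1) * ?Q j
          - of_nat (2 * j + 2) * ?P (Suc j)) / fact (Suc k)"
      unfolding fps_nth_Suc_deriv deriv_odd_basis fps_sub_nth fps_add_nth fps_of_nat_mult_nth e o
      by (simp only: times_divide_eq_right diff_divide_distrib[symmetric]
          add_divide_distrib[symmetric] divide_divide_eq_left fact_Suc of_nat_mult
          mult.commute[of "fact k"])
    ultimately show ?thesis
      by simp
  qed
  ultimately show ?case
    by blast
qed

lemma pseudo_factorial_eq_motzkin: "pseudo_factorial k = motzkin pf_level pf_descent k 0"
proof -
  have "(of_int (pseudo_factorial k) :: rat) = pf_motzkin k 0"
    using basis_nth_eq_motzkin[of 0 k] by (simp add: even_basis_def pf_egf_def)
  then show ?thesis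
    by simp
qed

lemma prod_pf_descent:
  "(\<Prod>i=1..m. pf_descent i) = (-1) ^ m * (3 ^ ((m + 1) div 2) * (fact m)\<^sup>2)"
  by (induction m) (auto simp: pf_descent_def power_mult_distrib elim!: evenE oddE)

lemma linear_recurrence_mod_pseudo_factorial:
  "linear_recurrence_mod pseudo_factorial (3 ^ ((m + 1) div 2) * (fact m)\<^sup>2) m"
proof -
  have "linear_recurrence_mod pseudo_factorial ((-1) ^ m * (3 ^ ((m + 1) div 2) * (fact m)\<^sup>2)) m"
    using linear_recurrence_mod_motzkin[of pf_level pf_descent m]
    by (simp only: prod_pf_descent pseudo_factorial_eq_motzkin[symmetric])
  then show ?thesis
    by (cases "even m") (simp_all add: linear_recurrence_mod_def cong_iff_dvd_diff)
qed

lemma eventually_periodic_mod_pseudo_factorial: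
  assumes "M > 0"
  shows "eventually_periodic_mod pseudo_factorial M"
proof -
  have "nat M dvd fact (nat M)"
    using assms by (intro dvd_fact) auto
  then have "int (nat M) dvd int (fact (nat M))"
    by (simp only: int_dvd_int_iff)
  then have "M dvd fact (nat M)"
    using assms by simp
  then have "M dvd 3 ^ ((nat M + 1) div 2) * (fact (nat M))\<^sup>2"
    by (simp add: power2_eq_square)
  then have "linear_recurrence_mod pseudo_factorial M (nat M)"
    using linear_recurrence_mod_pseudo_factorial[of "nat M"]
    unfolding linear_recurrence_mod_def by (meson cong_dvd_modulus)
  then show ?thesis
    using assms by (rule linear_recurrence_mod_imp_eventually_periodic_mod)
qed

theorem corollary2:
  shows "(\<forall>M::int. M \<ge> 2 \<longrightarrow> eventually_periodic_mod pseudo_factorial M) \<and>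
         (\<forall>m::nat. m \<ge> 2 \<longrightarrow>
           (\<exists>d\<le>m. linear_recurrence_mod pseudo_factorial
                      (3 ^ nat \<lceil>real m / 2\<rceil> * (fact m)\<^sup>2) d))"
proof -
  have "\<lceil>real m / 2\<rceil> = int ((m + 1) div 2)" for m
    by (rule ceiling_unique) (cases "even m"; auto elim!: evenE oddE)+
  then have "nat \<lceil>real m / 2\<rceil> = (m + 1) div 2" for m
    by simp
  then show ?thesis
    using eventually_periodic_mod_pseudo_factorial linear_recurrence_mod_pseudo_factorial
    by (metis le_refl less_le_trans zero_less_numeral)
qed

end
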